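(* Fix $\lambda>0$. For each integer $n>\lambda$ let $p=\lambda/n$, $p_i=p(1-p)^{i-1}$ for $1\le i\le n$, and $p_0=(1-p)^n$ (so $\sum_{i=0}^n p_i=1$). Discrete model: draw coupons independently one after another, each being of type $i$ with probability $p_i$, $0\le i\le n$, and let $D=D^{(n)}$ be the number of draws (including draws of type $0$) until every one of the types $1,\dots,n$ has been drawn at least once. Continuous model: let $T_1,\dots,T_n$ be independent with $T_i\sim\mathrm{Exp}(p_i)$, and let $T=T^{(n)}=\max_{1\le i\le n}T_i$. Then: (a) $E(D)=E(T)$. (b) As $n\to\infty$, $$E(T)=\frac{e^{\lambda}}{\lambda}\, n\left(\log n-\log\log n+\gamma-\log\lambda\right)+O\left(\frac{n\log\log n}{\log n}\right).$$
   Context: $\log$ is the natural logarithm and $\gamma=0.577\ldots$ is the Euler–Mascheroni constant. $\mathrm{Exp}(p)$ is the exponential distribution with rate $p$, i.e. $P(T_i>t)=e^{-p_i t}$ for $t\ge 0$. The constant implied in the $O$-term may depend on $\lambda$. *)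

theory Defs
  imports "HOL-Probability.Probability" "HOL-Library.Landau_Symbols"
begin

definition coupon_prob :: "real \<Rightarrow> nat \<Rightarrow> nat \<Rightarrow> real" where
  "coupon_prob lam n i =
     (let p = lam / real n in if i = 0 then (1 - p) ^ n else p * (1 - p) ^ (i - 1))"

lemma sum_coupon_prob: "(\<Sum>i\<le>n. coupon_prob lam n i) = 1"
proof -
  define p where "p = lam / real n"
  have "(\<Sum>i<k. p * (1 - p) ^ i) = 1 - (1 - p) ^ k" for k
    by (induction k) (auto simp: algebra_simps)
  then show ?thesis
    by (simp add: sum.atMost_shift coupon_prob_def flip: p_def)
qed

text \<open>Draws are numbered from 0. Only the probabilities of the values up to \<open>n\<close> are
  prescribed; they sum to 1, so every draw lies in \<open>{0..n}\<close> almost surely.\<close>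

definition coupon_draws ::
    "real \<Rightarrow> nat \<Rightarrow> 'a measure \<Rightarrow> (nat \<Rightarrow> 'a \<Rightarrow> nat) \<Rightarrow> bool" where
  "coupon_draws lam n M X \<longleftrightarrow>
     prob_space M \<and>
     prob_space.indep_vars M (\<lambda>_. count_space UNIV) X UNIV \<and>
     (\<forall>k. \<forall>i\<le>n. measure M {\<omega> \<in> space M. X k \<omega> = i} = coupon_prob lam n i)"

text \<open>The value is \<open>\<infinity>\<close> on outcomes where some type in \<open>{1..n}\<close> is never drawn.\<close>

definition draws_needed :: "nat \<Rightarrow> (nat \<Rightarrow> 'a \<Rightarrow> nat) \<Rightarrow> 'a \<Rightarrow> enat" where
  "draws_needed n X \<omega> = Inf {enat m |m. {1..n} \<subseteq> (\<lambda>k. X k \<omega>) ` {..<m}}"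

definition coupon_clocks ::
    "real \<Rightarrow> nat \<Rightarrow> 'b measure \<Rightarrow> (nat \<Rightarrow> 'b \<Rightarrow> real) \<Rightarrow> bool" where
  "coupon_clocks lam n N T \<longleftrightarrow>
     prob_space N \<and>
     prob_space.indep_vars N (\<lambda>_. borel) T {1..n} \<and>
     (\<forall>i\<in>{1..n}. distributed N lborel (T i) (exponential_density (coupon_prob lam n i)))"

definition max_time :: "nat \<Rightarrow> (nat \<Rightarrow> 'b \<Rightarrow> real) \<Rightarrow> 'b \<Rightarrow> real" where
  "max_time n T \<omega> = Max ((\<lambda>i. T i \<omega>) ` {1..n})"

end

(* Inclusion-exclusion gives P(T > t) = sum over nonempty S of (-1)^(|S|+1) exp(-p_S t) and
   P(D > k) = the same sum with (1 - p_S)^k, where p_S is the total rate of S. Integrating over t,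
   respectively summing over k, turns both into the sum of (-1)^(|S|+1) / p_S.

   For (b), divide the rates by the smallest one, p_n; they become (1+rho)^j, j < n, with
   rho = lam/(n-lam), and E(T) = (1/p_n) * integral of 1 - prod_j (1 - exp(-(1+rho)^j t)).
   The product is close to exp(- sum_j exp(-(1+rho)^j t)), and for t near log n the inner sum is
   close to m exp(-t) with m = n/(lam log n), so the integral is compared with
   integral of 1 - (1 - exp(-t))^m, which is the harmonic number H_m.
   For t below s = log n - 2 log log n both products are negligible, and for t above log n both are
   close to 1; H_m = log m + gamma + O(1/m) then gives the expansion. *)

theory Submission
  imports Defs "HOL-Real_Asymp.Real_Asymp"
begin

section \<open>Expectation of the maximum\<close>

text \<open>The inclusion-exclusion value of the mean of the maximum of independent exponential variables
  with rates \<open>p i\<close>, \<open>i \<in> A\<close>.\<close>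

definition max_mean :: "('i \<Rightarrow> real) \<Rightarrow> 'i set \<Rightarrow> real" where
  "max_mean p A = (\<Sum>S\<in>Pow A - {{}}. (- 1) ^ (card S + 1) / sum p S)"

text \<open>Inclusion-exclusion as a ring identity: the product expands over the subsets of
  \<open>A\<close>, and the empty subset cancels the leading 1. It is applied to exponentials for
  the clocks and to indicators for the draws.\<close>

lemma one_minus_prod_one_minus:
  fixes x :: "'i \<Rightarrow> 'a :: comm_ring_1"
  assumes "finite A"
  shows "1 - (\<Prod>i\<in>A. 1 - x i) = (\<Sum>S\<in>Pow A - {{}}. (- 1) ^ (card S + 1) * prod x S)"
proof -
  have "(\<Prod>i\<in>A. 1 - x i) = (\<Prod>i\<in>A. - x i + 1)"
    by simp
  also have "\<dots> = (\<Sum>S\<in>Pow A. (- 1) ^ card S * prod x S)"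
    using assms by (subst prod_add) (simp_all add: prod_uminus)
  also have "\<dots> = 1 + (\<Sum>S\<in>Pow A - {{}}. (- 1) ^ card S * prod x S)"
    using assms by (subst sum.remove[of _ "{}"]) auto
  finally show ?thesis
    by (simp add: sum_negf)
qed

text \<open>Scaling all rates scales time. This lets the smallest coupon rate be normalised to
  1.\<close>

lemma max_mean_scale: "max_mean (\<lambda>i. c * p i) A = max_mean p A / c"
  by (simp add: max_mean_def sum_divide_distrib mult.commute flip: sum_distrib_left)

lemma max_mean_cong:
  "(\<And>i. i \<in> A \<Longrightarrow> p i = q i) \<Longrightarrow> max_mean p A = max_mean q A"
  unfolding max_mean_def by (intro sum.cong arg_cong2[of _ _ _ _ "(/)"] refl) auto

text \<open>The lower end is left free: \<open>b = 0\<close> serves the inclusion-exclusion terms,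
  \<open>b = u\<close> the range beyond the cut-off in \<open>harm_le_max_mean\<close>.\<close>

lemma has_bochner_integral_exp_Ici:
  assumes "0 < (a::real)"
  shows "has_bochner_integral lborel (\<lambda>t. indicator {b..} t * exp (- a * t)) (exp (- a * b) / a)"
proof (rule has_bochner_integral_nn_integral)
  have "(\<integral>\<^sup>+t. ennreal (indicator {b..} t * exp (- a * t)) \<partial>lborel) =
      (\<integral>\<^sup>+t. ennreal (exp (- a * t)) * indicator {b..} t \<partial>lborel)"
    by (intro nn_integral_cong) (simp split: split_indicator)
  also have "\<dots> = ennreal (0 - (- exp (- a * b) / a))"
  proof (rule nn_integral_FTC_atLeast)
    show "((\<lambda>t. - exp (- a * t) / a) \<longlongrightarrow> 0) at_top"
      using assms by real_asymp
  qed (use assms in \<open>auto intro!: derivative_eq_intros\<close>)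
  finally show "(\<integral>\<^sup>+t. ennreal (indicator {b..} t * exp (- a * t)) \<partial>lborel) =
      ennreal (exp (- a * b) / a)"
    by simp
qed (use assms in auto)

lemma sum_pos_nonempty_subset:
  fixes p :: "'i \<Rightarrow> real"
  assumes "finite A" "\<And>i. i \<in> A \<Longrightarrow> 0 < p i" "S \<subseteq> A" "S \<noteq> {}"
  shows "0 < sum p S"
  using assms by (intro sum_pos) (auto intro: finite_subset)

text \<open>Inclusion-exclusion splits the integrand into terms \<open>exp (- sum p S * t)\<close>.
  Since \<open>S\<close> is nonempty, \<open>sum p S\<close> is positive and each term integrates to
  \<open>1 / sum p S\<close>. No probability space occurs, so the formula also serves the comparison
  with harmonic numbers.\<close>

lemma has_bochner_integral_max_mean:
  assumes "finite A" "\<And>i. i \<in> A \<Longrightarrow> 0 < p i"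
  shows "has_bochner_integral lborel
    (\<lambda>t. indicator {0..} t * (1 - (\<Prod>i\<in>A. 1 - exp (- p i * t)))) (max_mean p A)"
proof -
  have eq: "indicator {0..} t * (1 - (\<Prod>i\<in>A. 1 - exp (- p i * t))) =
     (\<Sum>S\<in>Pow A - {{}}. (- 1) ^ (card S + 1) * (indicator {0..} t * exp (- sum p S * t)))" for t
  proof -
    have "(\<Prod>i\<in>S. exp (- p i * t)) = exp (- sum p S * t)" if "S \<subseteq> A" for S
      using finite_subset[OF that assms(1)]
      by (simp add: exp_sum[symmetric] sum_distrib_right sum_negf)
    then show ?thesis
      by (subst one_minus_prod_one_minus[OF assms(1)])
        (auto simp: sum_distrib_left mult_ac intro!: sum.cong)
  qed
  have "has_bochner_integral lborel
     (\<lambda>t. \<Sum>S\<in>Pow A - {{}}. (- 1) ^ (card S + 1) * (indicator {0..} t * exp (- sum p S * t)))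
     (\<Sum>S\<in>Pow A - {{}}. (- 1) ^ (card S + 1) * (1 / sum p S))"
    using assms sum_pos_nonempty_subset[of A p] has_bochner_integral_exp_Ici[where b = 0]
    by (intro has_bochner_integral_sum has_bochner_integral_mult_right) auto
  then show ?thesis
    unfolding eq max_mean_def by simp
qed

lemma tail_integrand_nonneg:
  assumes "\<And>i. i \<in> A \<Longrightarrow> 0 < (p i :: real)"
  shows "0 \<le> indicator {0..} t * (1 - (\<Prod>i\<in>A. 1 - exp (- p i * t)))"
  using assms by (auto split: split_indicator intro!: prod_le_1 mult_nonneg_nonneg simp: less_imp_le)

lemma max_mean_nonneg:
  assumes "finite A" "\<And>i. i \<in> A \<Longrightarrow> 0 < p i"
  shows "0 \<le> max_mean p A"
proof -
  have "0 \<le> (\<integral>t. indicator {0..} t * (1 - (\<Prod>i\<in>A. 1 - exp (- p i * t))) \<partial>lborel)"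
    using assms(2) by (intro Bochner_Integration.integral_nonneg tail_integrand_nonneg)
  then show ?thesis
    using has_bochner_integral_max_mean[OF assms] by (simp add: has_bochner_integral_iff)
qed

context prob_space
begin

text \<open>By Fubini, the mean of an almost surely nonnegative variable is the integral of its
  tail; by independence, the distribution function of the maximum is the product of the individual
  ones.\<close>

lemma exponential_Max:
  assumes A: "finite A" "A \<noteq> {}"
    and p: "\<And>i. i \<in> A \<Longrightarrow> 0 < p i"
    and ind: "indep_vars (\<lambda>_. borel) T A"
    and T: "\<And>i. i \<in> A \<Longrightarrow> distributed M lborel (T i) (exponential_density (p i))"
  shows "has_bochner_integral M (\<lambda>\<omega>. Max ((\<lambda>i. T i \<omega>) ` A)) (max_mean p A)"
proof (rule has_bochner_integral_nn_integral)
  let ?Z = "\<lambda>\<omega>. Max ((\<lambda>i. T i \<omega>) ` A)"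
  have [measurable]: "T i \<in> borel_measurable M" if "i \<in> A" for i
    using T[OF that] by (auto simp: distributed_def)
  show Z[measurable]: "?Z \<in> borel_measurable M"
    using A by (intro borel_measurable_Max) auto
  have tail: "prob {\<omega> \<in> space M. t < ?Z \<omega>} = 1 - (\<Prod>i\<in>A. 1 - exp (- p i * t))" if "0 \<le> t" for t
  proof -
    have eq: "{\<omega> \<in> space M. ?Z \<omega> \<le> t} = (\<Inter>i\<in>A. T i -` {..t} \<inter> space M)"
      using A by (auto simp: Max_le_iff)
    have "prob (\<Inter>i\<in>A. T i -` {..t} \<inter> space M) = (\<Prod>i\<in>A. prob (T i -` {..t} \<inter> space M))"
      using ind unfolding indep_vars_def2
      by (intro indep_setsD[of _ A]) (auto simp: A intro!: exI[of _ "{..t}"])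
    also have "\<dots> = (\<Prod>i\<in>A. 1 - exp (- p i * t))"
    proof (intro prod.cong refl)
      fix i assume i: "i \<in> A"
      have "T i -` {..t} \<inter> space M = {\<omega> \<in> space M. T i \<omega> \<le> t}"
        by auto
      then show "prob (T i -` {..t} \<inter> space M) = 1 - exp (- p i * t)"
        using exponential_distributedD_le[OF T[OF i] that p[OF i]] by (simp add: mult.commute)
    qed
    finally have "prob {\<omega> \<in> space M. ?Z \<omega> \<le> t} = (\<Prod>i\<in>A. 1 - exp (- p i * t))"
      by (simp add: eq)
    moreover have "{\<omega> \<in> space M. t < ?Z \<omega>} = space M - {\<omega> \<in> space M. ?Z \<omega> \<le> t}"
      by auto
    moreover have "{\<omega> \<in> space M. ?Z \<omega> \<le> t} \<in> events"
      by measurable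
    ultimately show ?thesis
      by (simp add: prob_compl)
  qed
  \<comment> \<open>A single clock is almost surely positive, and the maximum is at least as
    large.\<close>
  show "AE \<omega> in M. 0 \<le> ?Z \<omega>"
  proof -
    obtain i where i: "i \<in> A"
      using A by auto
    have "AE \<omega> in M. \<omega> \<in> {\<omega> \<in> space M. 0 < T i \<omega>}"
      using exponential_distributedD_gt[OF T[OF i] order_refl p[OF i]] by (intro AE_prob_1) simp
    then show ?thesis
    proof eventually_elim
      case (elim \<omega>)
      have "T i \<omega> \<le> ?Z \<omega>"
        using A i by (intro Max_ge) auto
      with elim show ?case
        by simp
    qed
  qed
  interpret pair_sigma_finite M lborel
    by unfold_locales
  have "(\<integral>\<^sup>+\<omega>. ennreal (?Z \<omega>) \<partial>M) = (\<integral>\<^sup>+\<omega>. \<integral>\<^sup>+t. indicator {0..<?Z \<omega>} t \<partial>lborel \<partial>M)"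
  proof (intro nn_integral_cong)
    fix \<omega>
    show "ennreal (?Z \<omega>) = (\<integral>\<^sup>+t. indicator {0..<?Z \<omega>} t \<partial>lborel)"
      \<comment> \<open>For a negative value \<open>ennreal\<close> gives 0 and the interval is
        empty.\<close>
      by (cases "0 \<le> ?Z \<omega>") (simp_all add: ennreal_neg)
  qed
  \<comment> \<open>Fubini needs joint measurability, so the indicator is rewritten as that of a
    region in the product space.\<close>
  also have "\<dots> = (\<integral>\<^sup>+\<omega>. \<integral>\<^sup>+t. indicator {p. 0 \<le> snd p \<and> snd p < ?Z (fst p)} (\<omega>, t) \<partial>lborel \<partial>M)"
    by (intro nn_integral_cong) (auto split: split_indicator)
  also have "\<dots> = (\<integral>\<^sup>+t. \<integral>\<^sup>+\<omega>. indicator {p. 0 \<le> snd p \<and> snd p < ?Z (fst p)} (\<omega>, t) \<partial>M \<partial>lborel)"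
  proof (rule Fubini'[symmetric])
    show "(\<lambda>(\<omega>, t). indicator {p. 0 \<le> snd p \<and> snd p < ?Z (fst p)} (\<omega>, t) :: ennreal)
      \<in> borel_measurable (M \<Otimes>\<^sub>M lborel)"
      by measurable
  qed
  also have "\<dots> = (\<integral>\<^sup>+t. ennreal (indicator {0..} t * (1 - (\<Prod>i\<in>A. 1 - exp (- p i * t)))) \<partial>lborel)"
  proof (intro nn_integral_cong)
    fix t :: real
    have "(\<integral>\<^sup>+\<omega>. indicator {p. 0 \<le> snd p \<and> snd p < ?Z (fst p)} (\<omega>, t) \<partial>M) =
        (\<integral>\<^sup>+\<omega>. indicator {0..} t * indicator {\<omega> \<in> space M. t < ?Z \<omega>} \<omega> \<partial>M)"
      by (intro nn_integral_cong) (auto split: split_indicator)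
    also have "\<dots> = indicator {0..} t * emeasure M {\<omega> \<in> space M. t < ?Z \<omega>}"
      by (subst nn_integral_cmult) auto
    also have "\<dots> = ennreal (indicator {0..} t * (1 - (\<Prod>i\<in>A. 1 - exp (- p i * t))))"
      using tail by (auto simp: emeasure_eq_measure split: split_indicator)
    finally show "(\<integral>\<^sup>+\<omega>. indicator {p. 0 \<le> snd p \<and> snd p < ?Z (fst p)} (\<omega>, t) \<partial>M) = \<dots>" .
  qed
  also have "\<dots> = ennreal (max_mean p A)"
    using has_bochner_integral_max_mean[OF A(1), of p] tail_integrand_nonneg[of A p] p
    by (subst nn_integral_eq_integral) (auto simp: has_bochner_integral_iff)
  finally show "(\<integral>\<^sup>+\<omega>. ennreal (?Z \<omega>) \<partial>M) = ennreal (max_mean p A)" .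
qed (rule max_mean_nonneg[OF A(1) p])

end

section \<open>Expectation of the number of draws\<close>

text \<open>Covering is monotone in the number of draws, so the infimum exceeds \<open>t\<close>
  exactly when the first \<open>t\<close> draws do not cover. If no number of draws covers, the
  infimum of the empty set is infinity, which fits.\<close>

lemma less_draws_needed_iff:
  "enat t < draws_needed n X \<omega> \<longleftrightarrow> \<not> {1..n} \<subseteq> (\<lambda>k. X k \<omega>) ` {..<t}"
proof -
  let ?C = "\<lambda>m. {1..n} \<subseteq> (\<lambda>k. X k \<omega>) ` {..<m}"
  have mono: "?C t" if "?C m" "m \<le> t" for m
  proof -
    have "(\<lambda>k. X k \<omega>) ` {..<m} \<subseteq> (\<lambda>k. X k \<omega>) ` {..<t}"
      using that(2) by (intro image_mono) simp
    with that(1) show ?thesis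
      by (rule subset_trans)
  qed
  have "enat t < Inf {enat m |m. ?C m} \<longleftrightarrow> (\<forall>m. ?C m \<longrightarrow> t < m)"
  proof
    assume *: "enat t < Inf {enat m |m. ?C m}"
    show "\<forall>m. ?C m \<longrightarrow> t < m"
    proof (intro allI impI)
      fix m assume "?C m"
      then have "Inf {enat m |m. ?C m} \<le> enat m"
        by (intro Inf_lower) blast
      with * have "enat t < enat m"
        by (rule less_le_trans)
      then show "t < m"
        by simp
    qed
  next
    assume *: "\<forall>m. ?C m \<longrightarrow> t < m"
    \<comment> \<open>A lower bound on all elements passes to the infimum only as a weak inequality;
      stepping up to \<open>Suc t\<close> recovers strictness.\<close>
    have "enat (Suc t) \<le> Inf {enat m |m. ?C m}"
    proof (rule Inf_greatest)
      fix x assume "x \<in> {enat m |m. ?C m}"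
      then obtain m where "x = enat m" "?C m"
        by blast
      with * show "enat (Suc t) \<le> x"
        by (simp only: enat_ord_simps Suc_le_eq)
    qed
    then show "enat t < Inf {enat m |m. ?C m}"
      by (rule less_le_trans[rotated]) simp
  qed
  also have "\<dots> \<longleftrightarrow> \<not> ?C t"
    using mono by (meson leI less_irrefl)
  finally show ?thesis
    unfolding draws_needed_def .
qed

text \<open>As \<open>enat\<close> is countable, preimages of points suffice: a finite value is a
  difference of complements of tail events, and infinity is the intersection of all tail
  events.\<close>

lemma measurable_enat_iff_less:
  fixes f :: "'a \<Rightarrow> enat"
  assumes "\<And>t. {\<omega> \<in> space M. enat t < f \<omega>} \<in> sets M"
  shows "f \<in> measurable M (count_space UNIV)"
proof (subst measurable_count_space_eq2_countable, safe)
  fix a :: enat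
  have le: "{\<omega> \<in> space M. f \<omega> \<le> enat t} \<in> sets M" for t
  proof -
    have "{\<omega> \<in> space M. f \<omega> \<le> enat t} = space M - {\<omega> \<in> space M. enat t < f \<omega>}"
      by auto
    then show ?thesis
      using assms by auto
  qed
  show "f -` {a} \<inter> space M \<in> sets M"
  proof (cases a)
    case (enat m)
    have "f -` {a} \<inter> space M =
        {\<omega> \<in> space M. f \<omega> \<le> enat m} - (\<Union>t\<in>{..<m}. {\<omega> \<in> space M. f \<omega> \<le> enat t})"
    proof (intro set_eqI)
      fix \<omega>
      show "\<omega> \<in> f -` {a} \<inter> space M \<longleftrightarrow>
          \<omega> \<in> {\<omega> \<in> space M. f \<omega> \<le> enat m} - (\<Union>t\<in>{..<m}. {\<omega> \<in> space M. f \<omega> \<le> enat t})"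
        by (cases "f \<omega>") (auto simp: enat order.order_iff_strict)
    qed
    then show ?thesis
      using le by auto
  next
    case infinity
    have "f -` {a} \<inter> space M = (\<Inter>t. {\<omega> \<in> space M. enat t < f \<omega>})"
    proof (intro set_eqI)
      fix \<omega>
      show "\<omega> \<in> f -` {a} \<inter> space M \<longleftrightarrow> \<omega> \<in> (\<Inter>t. {\<omega> \<in> space M. enat t < f \<omega>})"
        by (cases "f \<omega>") (auto simp: infinity)
    qed
    then show ?thesis
      using assms by auto
  qed
qed auto

context prob_space
begin

text \<open>Inclusion-exclusion holds pointwise for the indicators of "type \<open>i\<close> is
  missing" and is then integrated. By independence, all types of \<open>S\<close> are missing with
  probability \<open>(1 - sum p S) ^ m\<close>.\<close>

lemma prob_not_covered:
  assumes A: "finite A" and ind: "indep_vars (\<lambda>_. count_space UNIV) X (UNIV :: nat set)"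
    and p: "\<And>k i. i \<in> A \<Longrightarrow> prob {\<omega> \<in> space M. X k \<omega> = i} = p i"
  shows "prob {\<omega> \<in> space M. \<not> A \<subseteq> (\<lambda>k. X k \<omega>) ` {..<m}} =
    (\<Sum>S\<in>Pow A - {{}}. (- 1) ^ (card S + 1) * (1 - sum p S) ^ m)"
proof -
  have rv[measurable]: "X k \<in> measurable M (count_space UNIV)" for k
    using ind by (simp add: indep_vars_def)
  define E where "E S = {\<omega> \<in> space M. \<forall>k<m. X k \<omega> \<notin> S}" for S
  have E[measurable]: "E S \<in> events" for S
  proof -
    have "E S = space M - (\<Union>k<m. X k -` S \<inter> space M)"
      by (auto simp: E_def)
    moreover have "X k -` S \<inter> space M \<in> events" for k
      by (rule measurable_sets[OF rv]) simp
    ultimately show ?thesis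
      by (simp only:) (intro sets.Diff sets.top sets.finite_UN finite_lessThan)
  qed
  have int: "integrable M (indicator (E S) :: 'a \<Rightarrow> real)" for S
    by (rule integrable_real_indicator[OF E]) (simp add: emeasure_eq_measure)
  have prob_E: "prob (E S) = (1 - sum p S) ^ m" if S: "S \<subseteq> A" for S
  \<comment> \<open>Independence is applied to a nonempty set of draws; for \<open>m = 0\<close> the
    event is the whole space.\<close>
  proof (cases "m = 0")
    case False
    have one: "prob (X k -` (- S) \<inter> space M) = 1 - sum p S" for k
    proof -
      have fin: "finite S"
        using S A by (rule finite_subset)
      have "prob (\<Union>i\<in>S. {\<omega> \<in> space M. X k \<omega> = i}) = (\<Sum>i\<in>S. prob {\<omega> \<in> space M. X k \<omega> = i})"
        by (intro finite_measure_finite_Union fin) (auto simp: disjoint_family_on_def)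
      also have "\<dots> = sum p S"
        using p S by (intro sum.cong) auto
      finally have "prob (\<Union>i\<in>S. {\<omega> \<in> space M. X k \<omega> = i}) = sum p S" .
      moreover have "(\<Union>i\<in>S. {\<omega> \<in> space M. X k \<omega> = i}) \<in> events"
        using fin by (intro sets.finite_UN) auto
      moreover have "X k -` (- S) \<inter> space M = space M - (\<Union>i\<in>S. {\<omega> \<in> space M. X k \<omega> = i})"
        by auto
      ultimately show ?thesis
        by (simp add: prob_compl)
    qed
    have "E S = (\<Inter>k\<in>{..<m}. X k -` (- S) \<inter> space M)"
      using False by (auto simp: E_def)
    also have "prob \<dots> = (\<Prod>k<m. prob (X k -` (- S) \<inter> space M))"
      using ind False unfolding indep_vars_def2
      by (intro indep_setsD[of _ UNIV]) auto
    finally show ?thesis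
      by (simp add: one)
  qed (simp add: E_def prob_space)
  have "indicator {\<omega> \<in> space M. \<not> A \<subseteq> (\<lambda>k. X k \<omega>) ` {..<m}} \<omega> =
      (\<Sum>S\<in>Pow A - {{}}. (- 1) ^ (card S + 1) * (indicator (E S) \<omega> :: real))"
    if \<omega>: "\<omega> \<in> space M" for \<omega>
  proof -
    have eq: "(\<Prod>i\<in>S. indicator (E {i}) \<omega>) = (indicator (E S) \<omega> :: real)" if "S \<subseteq> A" for S
    proof (cases "\<omega> \<in> E S")
      case True
      then have "\<forall>i\<in>S. \<omega> \<in> E {i}"
        by (auto simp: E_def)
      with True show ?thesis by simp
    next
      case False
      then obtain i where "i \<in> S" "\<omega> \<notin> E {i}"
        using \<omega> by (auto simp: E_def)
      with False show ?thesis
        using finite_subset[OF that A] by (auto intro!: prod_zero bexI[of _ i])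
    qed
    \<comment> \<open>If every type has appeared, all factors are 1; a missing type makes one factor
      0.\<close>
    have "indicator {\<omega> \<in> space M. \<not> A \<subseteq> (\<lambda>k. X k \<omega>) ` {..<m}} \<omega> =
        1 - (\<Prod>i\<in>A. 1 - (indicator (E {i}) \<omega> :: real))"
    proof (cases "A \<subseteq> (\<lambda>k. X k \<omega>) ` {..<m}")
      case True
      then have "\<omega> \<notin> E {i}" if "i \<in> A" for i
        using that by (auto simp: E_def)
      with True show ?thesis by simp
    next
      case False
      then obtain i where "i \<in> A" "\<omega> \<in> E {i}"
        using \<omega> by (auto simp: E_def)
      then have "(\<Prod>i\<in>A. 1 - (indicator (E {i}) \<omega> :: real)) = 0"
        using A by (auto intro!: prod_zero bexI[of _ i])
      with False \<omega> show ?thesis by simp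
    qed
    also have "\<dots> = (\<Sum>S\<in>Pow A - {{}}. (- 1) ^ (card S + 1) * (\<Prod>i\<in>S. indicator (E {i}) \<omega>))"
      by (rule one_minus_prod_one_minus[OF A])
    also have "\<dots> = (\<Sum>S\<in>Pow A - {{}}. (- 1) ^ (card S + 1) * indicator (E S) \<omega>)"
      using eq by (intro sum.cong) auto
    finally show ?thesis .
  qed
  then have "(\<integral>\<omega>. indicator {\<omega> \<in> space M. \<not> A \<subseteq> (\<lambda>k. X k \<omega>) ` {..<m}} \<omega> \<partial>M) =
      (\<integral>\<omega>. (\<Sum>S\<in>Pow A - {{}}. (- 1) ^ (card S + 1) * (indicator (E S) \<omega> :: real)) \<partial>M)"
    by (intro Bochner_Integration.integral_cong) auto
  also have "\<dots> = (\<Sum>S\<in>Pow A - {{}}. (- 1) ^ (card S + 1) * prob (E S))"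
    by (subst Bochner_Integration.integral_sum) (simp_all add: int)
  also have "\<dots> = (\<Sum>S\<in>Pow A - {{}}. (- 1) ^ (card S + 1) * (1 - sum p S) ^ m)"
    using prob_E by (intro sum.cong) auto
  finally show ?thesis
    by (simp add: Int_absorb2)
qed

text \<open>The mean is the sum of the tail probabilities, here a finite combination of geometric
  series with ratios \<open>1 - sum p S\<close>. The finite value shows in passing that all types
  are collected almost surely.\<close>

lemma nn_integral_draws_needed:
  assumes ind: "indep_vars (\<lambda>_. count_space UNIV) X UNIV"
    and p: "\<And>i. i \<in> {1..n} \<Longrightarrow> 0 < p i"
    and X: "\<And>k i. i \<in> {1..n} \<Longrightarrow> prob {\<omega> \<in> space M. X k \<omega> = i} = p i"
  shows "(\<integral>\<^sup>+\<omega>. ennreal_of_enat (draws_needed n X \<omega>) \<partial>M) = ennreal (max_mean p {1..n})"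
proof -
  have [measurable]: "X k \<in> measurable M (count_space UNIV)" for k
    using ind by (simp add: indep_vars_def)
  have less: "{\<omega> \<in> space M. enat t < draws_needed n X \<omega>} =
      {\<omega> \<in> space M. \<not> {1..n} \<subseteq> (\<lambda>k. X k \<omega>) ` {..<t}}" for t
    by (simp add: less_draws_needed_iff)
  have "{\<omega> \<in> space M. \<not> {1..n} \<subseteq> (\<lambda>k. X k \<omega>) ` {..<t}} \<in> events" for t
    unfolding subset_iff image_iff by measurable
  then have "draws_needed n X \<in> measurable M (count_space UNIV)"
    by (intro measurable_enat_iff_less) (simp add: less)
  then have "(\<integral>\<^sup>+\<omega>. ennreal_of_enat (draws_needed n X \<omega>) \<partial>M) =
      (\<Sum>t. ennreal (prob {\<omega> \<in> space M. \<not> {1..n} \<subseteq> (\<lambda>k. X k \<omega>) ` {..<t}}))"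
    by (subst nn_integral_enat_function) (simp_all add: less emeasure_eq_measure)
  also have "\<dots> = ennreal (max_mean p {1..n})"
  proof (rule suminf_ennreal_eq)
    have "(\<lambda>t. \<Sum>S\<in>Pow {1..n} - {{}}. (- 1) ^ (card S + 1) * (1 - sum p S) ^ t) sums
        (\<Sum>S\<in>Pow {1..n} - {{}}. (- 1) ^ (card S + 1) * (1 / (1 - (1 - sum p S))))"
    proof (intro sums_sum sums_mult geometric_sums)
      fix S assume S: "S \<in> Pow {1..n} - {{}}"
      then have "0 < sum p S"
        using p by (intro sum_pos_nonempty_subset[of "{1..n}"]) auto
      \<comment> \<open>This keeps the ratio away from -1. The sum is the probability that draw 0
        falls in \<open>S\<close>; any other draw would do.\<close>
      moreover have "sum p S \<le> 1"
      proof -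
        have fin: "finite S"
          using S by (auto intro: finite_subset)
        have "sum p S = (\<Sum>i\<in>S. prob {\<omega> \<in> space M. X 0 \<omega> = i})"
          using X S by (intro sum.cong) auto
        also have "\<dots> = prob (\<Union>i\<in>S. {\<omega> \<in> space M. X 0 \<omega> = i})"
          by (intro finite_measure_finite_Union[symmetric] fin) (auto simp: disjoint_family_on_def)
        finally show ?thesis by simp
      qed
      ultimately show "norm (1 - sum p S) < 1"
        by simp
    qed
    then show "(\<lambda>t. prob {\<omega> \<in> space M. \<not> {1..n} \<subseteq> (\<lambda>k. X k \<omega>) ` {..<t}}) sums max_mean p {1..n}"
      by (subst prob_not_covered[OF _ ind X]) (simp_all add: max_mean_def)
  qed simp
  finally show ?thesis .
qed

end

section \<open>Comparison with harmonic numbers\<close>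

text \<open>Consecutive integrands differ by \<open>exp (- t) * (1 - exp (- t)) ^ m\<close>, which
  has antiderivative \<open>(1 - exp (- t)) ^ Suc m / Suc m\<close>, so each step adds
  \<open>1 / Suc m\<close>.\<close>

lemma has_bochner_integral_harm:
  "has_bochner_integral lborel (\<lambda>t::real. indicator {0..} t * (1 - (1 - exp (- t)) ^ m)) (harm m)"
proof (induction m)
  case (Suc m)
  have "has_bochner_integral lborel (\<lambda>t::real. indicator {0..} t * (exp (- t) * (1 - exp (- t)) ^ m))
      (1 / real (Suc m))"
  proof (rule has_bochner_integral_nn_integral)
    have "(\<integral>\<^sup>+t. ennreal (indicator {0..} t * (exp (- t) * (1 - exp (- t)) ^ m)) \<partial>lborel) =
        (\<integral>\<^sup>+t. ennreal (exp (- t) * (1 - exp (- t)) ^ m) * indicator {0..} t \<partial>lborel)"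
      by (intro nn_integral_cong) (simp split: split_indicator)
    also have "\<dots> = ennreal (1 / real (Suc m) - (1 - exp (- 0)) ^ Suc m / real (Suc m))"
    proof (rule nn_integral_FTC_atLeast)
      have "((\<lambda>t::real. (1 - exp (- t)) ^ Suc m / real (Suc m)) \<longlongrightarrow> (1 - 0) ^ Suc m / real (Suc m)) at_top"
        by (intro tendsto_intros filterlim_compose[OF exp_at_bot] filterlim_uminus_at_bot_at_top) simp
      then show "((\<lambda>t::real. (1 - exp (- t)) ^ Suc m / real (Suc m)) \<longlongrightarrow> 1 / real (Suc m)) at_top"
        by simp
    next
      fix t :: real assume "0 \<le> t"
      then show "((\<lambda>t. (1 - exp (- t)) ^ Suc m / real (Suc m)) has_real_derivative
          exp (- t) * (1 - exp (- t)) ^ m) (at t)"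
        by (auto intro!: derivative_eq_intros simp del: power_Suc)
    qed auto
    finally show "(\<integral>\<^sup>+t. ennreal (indicator {0..} t * (exp (- t) * (1 - exp (- t)) ^ m)) \<partial>lborel) =
        ennreal (1 / real (Suc m))"
      by simp
  qed (auto split: split_indicator)
  from has_bochner_integral_add[OF Suc this] show ?case
    by (simp add: harm_Suc inverse_eq_divide algebra_simps)
qed (simp add: harm_def has_bochner_integral_zero)

lemma has_bochner_integral_le:
  fixes f g :: "'a \<Rightarrow> real"
  assumes "has_bochner_integral M f x" "has_bochner_integral M g y" "\<And>t. f t \<le> g t"
  shows "x \<le> y"
  using assms integral_mono[of M f g] by (simp add: has_bochner_integral_iff)

section \<open>Exponential bounds for products and comparison of integrands\<close>

lemma prod_one_minus_le_exp:
  fixes x :: "'i \<Rightarrow> real"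
  assumes "\<And>i. i \<in> A \<Longrightarrow> x i \<le> 1"
  shows "(\<Prod>i\<in>A. 1 - x i) \<le> exp (- sum x A)"
proof (cases "finite A")
  case True
  have "(\<Prod>i\<in>A. 1 - x i) \<le> (\<Prod>i\<in>A. exp (- x i))"
    using assms exp_ge_add_one_self[of "- x i" for i] by (intro prod_mono) auto
  with True show ?thesis
    by (simp add: exp_sum sum_negf[symmetric])
qed simp

text \<open>A partial converse of \<open>1 - x \<le> exp (- x)\<close>: it follows from
  \<open>1 / (1 - x) = 1 + x / (1 - x)\<close>, at the cost of the factor \<open>1 / (1 - y)\<close>
  in the exponent.\<close>

lemma exp_le_one_minus:
  assumes "0 \<le> x" "x \<le> y" "y < (1::real)"
  shows "exp (- (x / (1 - y))) \<le> 1 - x"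
proof -
  have "1 / (1 - x) = 1 + x / (1 - x)"
    using assms by (simp add: field_simps)
  also have "\<dots> \<le> 1 + x / (1 - y)"
    using assms by (intro add_left_mono divide_left_mono mult_pos_pos) auto
  also have "\<dots> \<le> exp (x / (1 - y))"
    by (rule exp_ge_add_one_self)
  finally have "1 \<le> exp (x / (1 - y)) * (1 - x)"
    using assms by (simp add: divide_le_eq)
  then show ?thesis
    by (simp add: exp_minus field_simps)
qed

lemma exp_le_prod_one_minus:
  fixes x :: "'i \<Rightarrow> real"
  assumes "\<And>i. i \<in> A \<Longrightarrow> 0 \<le> x i \<and> x i \<le> y" "y < 1"
  shows "exp (- (sum x A / (1 - y))) \<le> (\<Prod>i\<in>A. 1 - x i)"
proof (cases "finite A")
  case True
  have "exp (- (sum x A / (1 - y))) = (\<Prod>i\<in>A. exp (- (x i / (1 - y))))"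
    using True by (simp add: exp_sum[symmetric] sum_divide_distrib sum_negf)
  also have "\<dots> \<le> (\<Prod>i\<in>A. 1 - x i)"
    using assms by (intro prod_mono) (auto intro!: exp_le_one_minus)
  finally show ?thesis .
qed simp

text \<open>The integrands are compared pointwise. From \<open>s\<close> on, the hypothesis makes
  the product at least \<open>(1 - exp (- t)) ^ m\<close>. Before \<open>s\<close>, that power is at
  most \<open>exp (- real m * exp (- s))\<close>, and integrating this over \<open>{0..s}\<close>
  gives the error term.\<close>

lemma max_mean_le_harm:
  assumes A: "finite A" "\<And>i. i \<in> A \<Longrightarrow> 1 \<le> w i" and s: "0 < s"
    and sum_le: "\<And>t. s \<le> t \<Longrightarrow> (\<Sum>i\<in>A. exp (- w i * t)) \<le> real m * (1 - exp (- s)) * exp (- t)"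
  shows "max_mean w A \<le> harm m + s * exp (- real m * exp (- s))"
proof -
  let ?e = "exp (- real m * exp (- s))"
  let ?F = "\<lambda>t. \<Prod>i\<in>A. 1 - exp (- w i * t)"
  have w: "0 < w i" if "i \<in> A" for i
    using A(2)[OF that] by simp
  \<comment> \<open>Supplies the uniform bound \<open>y = exp (- s)\<close> for
    \<open>exp_le_prod_one_minus\<close>; this is where rates of at least 1 matter.\<close>
  have w_le: "exp (- w i * t) \<le> exp (- s)" if "i \<in> A" "s \<le> t" for i t
    using mult_mono[of 1 "w i" s t] A(2)[OF that(1)] s that(2) by simp
  have le: "indicator {0..} t * (1 - ?F t) \<le>
      indicator {0..} t * (1 - (1 - exp (- t)) ^ m) + ?e * indicator {0..s} t" for t
  proof (cases "s \<le> t")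
    case True
    have "(1 - exp (- t)) ^ m \<le> exp (- exp (- t)) ^ m"
      using True s exp_ge_add_one_self[of "- exp (- t)"] by (intro power_mono) auto
    also have "\<dots> = exp (- (real m * exp (- t)))"
      by (simp add: exp_of_nat_mult[symmetric])
    also have "\<dots> \<le> exp (- ((\<Sum>i\<in>A. exp (- w i * t)) / (1 - exp (- s))))"
      using sum_le[OF True] s by (simp add: divide_le_eq mult_ac)
    also have "\<dots> \<le> ?F t"
      using w_le[OF _ True] s by (intro exp_le_prod_one_minus) auto
    finally have F_ge: "(1 - exp (- t)) ^ m \<le> ?F t" .
    \<comment> \<open>Covers the point \<open>t = s\<close>, where the indicator of
      \<open>{0..s}\<close> is still 1.\<close>
    moreover have "(1 - exp (- t)) ^ m \<le> ?F t + ?e"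
      using F_ge by (rule add_increasing2[rotated]) simp
    ultimately show ?thesis
      by (auto split: split_indicator)
  next
    case False
    have "0 \<le> ?F t" if "0 \<le> t"
      using w that by (intro prod_nonneg) (auto simp: less_imp_le)
    moreover have "(1 - exp (- t)) ^ m \<le> ?e" if "0 \<le> t"
    proof -
      have "(1 - exp (- t)) ^ m \<le> (1 - exp (- s)) ^ m"
        using False that by (intro power_mono) auto
      also have "\<dots> \<le> exp (- exp (- s)) ^ m"
        using s exp_ge_add_one_self[of "- exp (- s)"] by (intro power_mono) auto
      finally show ?thesis
        by (simp add: exp_of_nat_mult[symmetric])
    qed
    ultimately show ?thesis
      using False by (auto split: split_indicator)
  qed
  have "has_bochner_integral lborel
      (\<lambda>t. indicator {0..} t * (1 - (1 - exp (- t)) ^ m) + ?e * indicator {0..s} t) (harm m + ?e * s)"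
    using s has_bochner_integral_real_indicator[of "{0..s}" lborel]
    by (intro has_bochner_integral_add has_bochner_integral_harm has_bochner_integral_mult_right) auto
  from has_bochner_integral_max_mean[OF A(1) w] this le have "max_mean w A \<le> harm m + ?e * s"
    by (rule has_bochner_integral_le)
  then show ?thesis
    by (simp add: mult.commute)
qed

text \<open>Reverse comparison, with the rate sum controlled only up to \<open>u\<close>. Beyond
  \<open>u\<close>, Bernoulli bounds the harmonic integrand by \<open>real m * exp (- t)\<close>;
  before \<open>s\<close>, monotonicity reduces the product to its value at
  \<open>s\<close>.\<close>

lemma harm_le_max_mean:
  assumes A: "finite A" "\<And>i. i \<in> A \<Longrightarrow> 1 \<le> w i" and s: "0 < s" "s \<le> u"
    and le_sum: "\<And>t. s \<le> t \<Longrightarrow> t \<le> u \<Longrightarrow>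
      real m * exp (- t) \<le> (1 - exp (- s)) * (\<Sum>i\<in>A. exp (- w i * t))"
  shows "harm m \<le> max_mean w A + s * exp (- real m * exp (- s)) + real m * exp (- u)"
proof -
  let ?e = "exp (- real m * exp (- s))"
  let ?F = "\<lambda>t. \<Prod>i\<in>A. 1 - exp (- w i * t)"
  have w: "0 < w i" if "i \<in> A" for i
    using A(2)[OF that] by simp
  have F_le: "?F t \<le> (1 - exp (- t)) ^ m" if t: "s \<le> t" "t \<le> u" for t
  proof -
    have "?F t \<le> exp (- (\<Sum>i\<in>A. exp (- w i * t)))"
      using w s t by (intro prod_one_minus_le_exp) (auto simp: less_imp_le)
    also have "\<dots> \<le> exp (- (real m * (exp (- t) / (1 - exp (- s)))))"
      using le_sum[OF t] s by (simp add: divide_le_eq mult_ac)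
    also have "\<dots> = exp (- (exp (- t) / (1 - exp (- s)))) ^ m"
      by (simp add: exp_of_nat_mult[symmetric])
    \<comment> \<open>The lossy bound is now spent on the single value
      \<open>exp (- t) \<le> exp (- s)\<close> instead of on the product.\<close>
    also have "\<dots> \<le> (1 - exp (- t)) ^ m"
      using s t by (intro power_mono exp_le_one_minus) auto
    finally show ?thesis .
  qed
  have F1: "?F t \<le> 1" if "0 \<le> t" for t
    using w that by (intro prod_le_1) (auto simp: less_imp_le)
  have le: "indicator {0..} t * (1 - (1 - exp (- t)) ^ m) \<le>
      indicator {0..} t * (1 - ?F t) + ?e * indicator {0..s} t + real m * (indicator {u..} t * exp (- 1 * t))" for t
  proof -
    consider "t < 0" | "0 \<le> t" "t < s" | "s \<le> t" "t \<le> u" | "u < t"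
      by linarith
    then show ?thesis
    proof cases
      case 2
      have "?F t \<le> ?F s"
        using w 2 by (intro prod_mono) (auto simp: less_imp_le)
      also have "\<dots> \<le> (1 - exp (- s)) ^ m"
        using s by (intro F_le) auto
      also have "\<dots> \<le> exp (- exp (- s)) ^ m"
        using s exp_ge_add_one_self[of "- exp (- s)"] by (intro power_mono) auto
      also have "\<dots> = ?e"
        by (simp add: exp_of_nat_mult[symmetric])
      finally have "?F t \<le> ?e" .
      moreover have "0 \<le> (1 - exp (- t)) ^ m"
        using 2 by simp
      ultimately have "?F t \<le> (1 - exp (- t)) ^ m + ?e"
        by linarith
      then show ?thesis
        using 2 s by (auto split: split_indicator)
    next
      case 3
      have "indicator {0..} t * (1 - (1 - exp (- t)) ^ m) \<le> indicator {0..} t * (1 - ?F t)"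
        using F_le[OF 3] by (intro mult_left_mono) auto
      moreover have "0 \<le> ?e * indicator {0..s} t + real m * (indicator {u..} t * exp (- 1 * t))"
        by simp
      ultimately show ?thesis
        by linarith
    next
      case 4
      have "1 + real m * (- exp (- t)) \<le> (1 + (- exp (- t))) ^ m"
        using s 4 by (intro Bernoulli_inequality) auto
      with F1[of t] 4 s show ?thesis
        by (auto split: split_indicator)
    qed (use s in auto)
  qed
  have "has_bochner_integral lborel
      (\<lambda>t. indicator {0..} t * (1 - ?F t) + ?e * indicator {0..s} t + real m * (indicator {u..} t * exp (- 1 * t)))
      (max_mean w A + ?e * s + real m * (exp (- 1 * u) / 1))"
    using s has_bochner_integral_real_indicator[of "{0..s}" lborel] A w
    by (intro has_bochner_integral_add has_bochner_integral_max_mean has_bochner_integral_mult_right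
        has_bochner_integral_exp_Ici) auto
  from has_bochner_integral_harm this le
  have "harm m \<le> max_mean w A + ?e * s + real m * (exp (- 1 * u) / 1)"
    by (rule has_bochner_integral_le)
  then show ?thesis
    by (simp add: mult.commute)
qed

section \<open>Geometrically growing rates\<close>

lemma max_mean_reindex:
  assumes "bij_betw h A B"
  shows "max_mean p B = max_mean (\<lambda>i. p (h i)) A"
proof -
  have "max_mean (\<lambda>i. p (h i)) A = (\<Sum>S\<in>Pow A - {{}}. (- 1) ^ (card (h ` S) + 1) / sum p (h ` S))"
    unfolding max_mean_def
  proof (intro sum.cong refl)
    fix S assume "S \<in> Pow A - {{}}"
    then have "inj_on h S"
      using assms by (auto simp: bij_betw_def intro: inj_on_subset)
    then show "(- 1) ^ (card S + 1) / (\<Sum>i\<in>S. p (h i)) =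
        (- 1) ^ (card (h ` S) + 1) / sum p (h ` S)"
      by (simp add: card_image sum.reindex)
  qed
  also have "\<dots> = max_mean p B"
    unfolding max_mean_def
  proof (rule sum.reindex_bij_betw)
    show "bij_betw ((`) h) (Pow A - {{}}) (Pow B - {{}})"
      using bij_betw_DiffI[OF bij_betw_Pow[OF assms], of "{{}}" "{{}}"]
      by (auto simp: bij_betw_def)
  qed
  finally show ?thesis ..
qed

text \<open>Bernoulli bounds \<open>(1 + \<rho>) ^ j\<close> below by \<open>1 + j * \<rho>\<close>,
  leaving a geometric series; then \<open>1 / (1 - exp (- x)) \<le> 1 + 1 / x\<close> with
  \<open>x = t * \<rho>\<close>. The bound is uniform in \<open>n\<close>.\<close>

lemma sum_exp_power_le:
  fixes \<rho> s t :: real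
  assumes "0 < \<rho>" "0 < s" "s \<le> t"
  shows "(\<Sum>j<n. exp (- ((1 + \<rho>) ^ j) * t)) \<le> (1 + 1 / (s * \<rho>)) * exp (- t)"
proof -
  have x: "0 < t * \<rho>"
    using assms by auto
  have "(\<Sum>j<n. exp (- ((1 + \<rho>) ^ j) * t)) \<le> (\<Sum>j<n. exp (- t) * exp (- (t * \<rho>)) ^ j)"
  proof (intro sum_mono)
    fix j
    have "(1 + real j * \<rho>) * t \<le> (1 + \<rho>) ^ j * t"
      using assms by (intro mult_right_mono Bernoulli_inequality) auto
    then show "exp (- ((1 + \<rho>) ^ j) * t) \<le> exp (- t) * exp (- (t * \<rho>)) ^ j"
      by (simp add: exp_of_nat_mult[symmetric] exp_add[symmetric] algebra_simps)
  qed
  also have "\<dots> = exp (- t) * ((1 - exp (- (t * \<rho>)) ^ n) / (1 - exp (- (t * \<rho>))))"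
    using x by (auto simp: sum_distrib_left[symmetric] sum_gp_strict)
  also have "\<dots> \<le> exp (- t) * (1 / (1 - exp (- (t * \<rho>))))"
    using x by (intro mult_left_mono divide_right_mono) auto
  also have "\<dots> \<le> exp (- t) * (1 + 1 / (t * \<rho>))"
  proof (intro mult_left_mono)
    have "exp (- (t * \<rho>)) \<le> 1 / (1 + t * \<rho>)"
      using exp_ge_add_one_self[of "t * \<rho>"] x by (simp add: exp_minus field_simps)
    then have "1 - 1 / (1 + t * \<rho>) \<le> 1 - exp (- (t * \<rho>))"
      by simp
    moreover have "1 - 1 / (1 + t * \<rho>) = t * \<rho> / (1 + t * \<rho>)"
      using x by (simp add: field_simps)
    ultimately have "1 / (1 - exp (- (t * \<rho>))) \<le> 1 / (t * \<rho> / (1 + t * \<rho>))"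
      using x by (intro divide_left_mono mult_pos_pos) auto
    also have "\<dots> = 1 + 1 / (t * \<rho>)"
      using x by (auto simp: add_divide_distrib)
    finally show "1 / (1 - exp (- (t * \<rho>))) \<le> 1 + 1 / (t * \<rho>)" .
  qed auto
  also have "\<dots> \<le> exp (- t) * (1 + 1 / (s * \<rho>))"
    using assms by (intro mult_left_mono add_left_mono divide_left_mono mult_right_mono mult_pos_pos) auto
  finally show ?thesis
    by (simp add: mult.commute)
qed

lemma exp_minus_one_le:
  assumes "0 \<le> x" "x \<le> (1::real)"
  shows "exp x - 1 \<le> x * (1 + x)"
  using exp_bound[OF assms] by (simp add: algebra_simps power2_eq_square)

text \<open>Only the first \<open>Y\<close> terms are kept. There
  \<open>(1 + \<rho>) ^ j - 1\<close> is at most \<open>\<rho> * j * (1 + \<rho> * Y)\<close>, so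
  for \<open>t \<le> u\<close> the terms dominate a geometric series of ratio
  \<open>exp (- c)\<close>, summed using \<open>1 - exp (- c) \<le> c\<close>.\<close>

lemma le_sum_exp_power:
  fixes \<rho> t u c :: real
  assumes \<rho>: "0 < \<rho>" "\<rho> * Y \<le> 1" and t: "0 \<le> t" "t \<le> u"
    and c: "u * \<rho> * (1 + \<rho> * Y) \<le> c" "0 < c" and Y: "Y \<le> n"
  shows "(1 - exp (- c * real Y)) / c * exp (- t) \<le> (\<Sum>j<n. exp (- ((1 + \<rho>) ^ j) * t))"
proof -
  have "(1 - exp (- c * real Y)) / c \<le> (1 - exp (- c * real Y)) / (1 - exp (- c))"
    using c(2) exp_ge_add_one_self[of "- c"] by (intro divide_left_mono) auto
  also have "\<dots> = (\<Sum>j<Y. exp (- c) ^ j)"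
  proof -
    have "exp (- c * real Y) = exp (- c) ^ Y"
      by (simp add: exp_of_nat_mult[symmetric] mult.commute)
    with c(2) show ?thesis
      by (simp add: sum_gp_strict)
  qed
  finally have "(1 - exp (- c * real Y)) / c * exp (- t) \<le> (\<Sum>j<Y. exp (- c) ^ j) * exp (- t)"
    by (rule mult_right_mono) simp
  also have "\<dots> = (\<Sum>j<Y. exp (- c) ^ j * exp (- t))"
    by (simp add: sum_distrib_right)
  also have "\<dots> \<le> (\<Sum>j<Y. exp (- ((1 + \<rho>) ^ j) * t))"
  proof (intro sum_mono)
    fix j assume j: "j \<in> {..<Y}"
    have jY: "\<rho> * real j \<le> \<rho> * real Y"
      using j \<rho> by auto
    have "(1 + \<rho>) ^ j \<le> exp \<rho> ^ j"
      using \<rho> by (intro power_mono) (auto simp: exp_ge_add_one_self)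
    also have "\<dots> = exp (\<rho> * real j)"
      by (simp add: exp_of_nat_mult[symmetric] mult.commute)
    finally have "(1 + \<rho>) ^ j - 1 \<le> \<rho> * real j * (1 + \<rho> * real j)"
      using exp_minus_one_le[of "\<rho> * real j"] \<rho> jY by simp
    also have "\<dots> \<le> \<rho> * real j * (1 + \<rho> * real Y)"
      using jY \<rho> by (intro mult_left_mono) auto
    finally have "t * ((1 + \<rho>) ^ j - 1) \<le> t * (\<rho> * real j * (1 + \<rho> * real Y))"
      using t by (intro mult_left_mono) auto
    also have "\<dots> \<le> u * (\<rho> * real j * (1 + \<rho> * real Y))"
      using t \<rho> by (intro mult_right_mono) auto
    also have "\<dots> = u * \<rho> * (1 + \<rho> * real Y) * real j"
      by simp
    also have "\<dots> \<le> c * real j"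
      using c by (intro mult_right_mono) auto
    finally show "exp (- c) ^ j * exp (- t) \<le> exp (- ((1 + \<rho>) ^ j) * t)"
      by (simp add: exp_of_nat_mult[symmetric] exp_add[symmetric] algebra_simps)
  qed
  also have "\<dots> \<le> (\<Sum>j<n. exp (- ((1 + \<rho>) ^ j) * t))"
    using Y by (intro sum_mono2) auto
  finally show ?thesis .
qed

section \<open>Explicit logarithmic bounds for harmonic numbers\<close>

lemma harm_le: "harm m \<le> euler_mascheroni + ln (real m + 1)"
proof (cases m)
  case 0
  then show ?thesis
    using euler_mascheroni_pos by (simp add: harm_def less_imp_le)
next
  case (Suc k)
  have "harm m - ln (real k + 2) \<le> euler_mascheroni - 1 / real (2 * (k + 2))"
    using euler_mascheroni_lower[of k] Suc by (simp add: algebra_simps)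
  moreover have "0 \<le> 1 / real (2 * (k + 2))"
    by simp
  ultimately have "harm m - ln (real k + 2) \<le> euler_mascheroni"
    by linarith
  with Suc show ?thesis
    by (simp add: algebra_simps)
qed

text \<open>The sequence \<open>harm n - ln n\<close> decreases to its limit, the Euler-Mascheroni
  constant.\<close>

lemma harm_ge:
  assumes "0 < m"
  shows "euler_mascheroni + ln (real m) \<le> harm m"
proof -
  have "euler_mascheroni \<le> harm m - ln (real m)"
  proof (rule LIMSEQ_le_const2[OF euler_mascheroni_LIMSEQ])
    show "\<exists>N. \<forall>n\<ge>N. harm n - ln (real n) \<le> harm m - ln (real m)"
      using euler_mascheroni_sequence_decreasing[OF assms] by blast
  qed
  then show ?thesis
    by simp
qed

section \<open>Bounds for geometric rates with free real parameters\<close>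

text \<open>\<open>A\<close> is the real number of unit clocks that matches the rate sum. Rounding
  it up costs 1 and \<open>harm_le\<close> another 1, hence \<open>A + 2\<close>.\<close>

lemma max_mean_power_le:
  fixes \<rho> s A :: real
  assumes \<rho>: "0 < \<rho>" and s: "0 < s" and A: "A = (1 + 1 / (s * \<rho>)) / (1 - exp (- s))"
  shows "max_mean (\<lambda>j. (1 + \<rho>) ^ j) {..<n} \<le>
    euler_mascheroni + ln (A + 2) + s * exp (- A * exp (- s))"
proof -
  define m where "m = nat \<lceil>A\<rceil>"
  have A0: "0 \<le> A"
    unfolding A using \<rho> s by (intro divide_nonneg_nonneg) auto
  then have m: "A \<le> real m" "real m \<le> A + 1"
    unfolding m_def by linarith+
  have "(\<Sum>j<n. exp (- ((1 + \<rho>) ^ j) * t)) \<le> real m * (1 - exp (- s)) * exp (- t)" if "s \<le> t" for t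
  proof -
    have "(\<Sum>j<n. exp (- ((1 + \<rho>) ^ j) * t)) \<le> (1 + 1 / (s * \<rho>)) * exp (- t)"
      using \<rho> s that by (rule sum_exp_power_le)
    also have "1 + 1 / (s * \<rho>) = A * (1 - exp (- s))"
      using s by (simp add: A)
    also have "A * (1 - exp (- s)) * exp (- t) \<le> real m * (1 - exp (- s)) * exp (- t)"
      using m s by (intro mult_right_mono) auto
    finally show ?thesis .
  qed
  then have "max_mean (\<lambda>j. (1 + \<rho>) ^ j) {..<n} \<le> harm m + s * exp (- real m * exp (- s))"
    using \<rho> s by (intro max_mean_le_harm) auto
  also have "harm m \<le> euler_mascheroni + ln (A + 2)"
    using harm_le[of m] m A0 ln_mono[of "real m + 1" "A + 2"] by linarith
  also have "s * exp (- real m * exp (- s)) \<le> s * exp (- A * exp (- s))"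
    using m s by (intro mult_left_mono) auto
  finally show ?thesis
    by simp
qed

text \<open>The margins \<open>y + 1\<close> and \<open>B - 1\<close> absorb the rounding of
  \<open>y\<close> up and of \<open>B\<close> down, so that all parameters can be real functions of
  \<open>n\<close>. \<open>1 < B\<close> makes the rounded number of clocks positive.\<close>

lemma le_max_mean_power:
  fixes \<rho> s u y c B :: real
  assumes \<rho>: "0 < \<rho>" "\<rho> * (y + 1) \<le> 1" and y: "0 \<le> y" "y + 1 \<le> real n"
    and s: "0 < s" "s \<le> u"
    and c: "c = u * \<rho> * (1 + \<rho> * (y + 1))"
    and B: "B = (1 - exp (- s)) * (1 - exp (- c * y)) / c" "1 < B"
  shows "euler_mascheroni + ln (B - 1) - s * exp (- (B - 1) * exp (- s)) - B * exp (- u) \<le>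
    max_mean (\<lambda>j. (1 + \<rho>) ^ j) {..<n}"
proof -
  define m where "m = nat \<lfloor>B\<rfloor>"
  define Y where "Y = nat \<lceil>y\<rceil>"
  have m: "real m \<le> B" "B - 1 \<le> real m" "0 < m"
    unfolding m_def using B(2) by linarith+
  have Y: "y \<le> real Y" "real Y \<le> y + 1" "Y \<le> n"
    unfolding Y_def using y by linarith+
  have \<rho>Y: "\<rho> * real Y \<le> \<rho> * (y + 1)"
    using Y \<rho> by (intro mult_left_mono) auto
  with \<rho>(2) have \<rho>Y1: "\<rho> * real Y \<le> 1"
    by linarith
  have c0: "0 < c"
    unfolding c using \<rho> s y by (intro mult_pos_pos add_pos_nonneg mult_nonneg_nonneg) auto
  have "real m * exp (- t) \<le> (1 - exp (- s)) * (\<Sum>j<n. exp (- ((1 + \<rho>) ^ j) * t))"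
    if t: "s \<le> t" "t \<le> u" for t
  proof -
    have "real m * exp (- t) \<le> B * exp (- t)"
      using m by (intro mult_right_mono) auto
    also have "\<dots> = (1 - exp (- s)) * ((1 - exp (- c * y)) / c * exp (- t))"
      by (simp add: B(1))
    also have "\<dots> \<le> (1 - exp (- s)) * ((1 - exp (- c * real Y)) / c * exp (- t))"
      using c0 Y s by (intro mult_left_mono mult_right_mono divide_right_mono) auto
    also have "\<dots> \<le> (1 - exp (- s)) * (\<Sum>j<n. exp (- ((1 + \<rho>) ^ j) * t))"
    proof (intro mult_left_mono le_sum_exp_power[where u = u])
      show "u * \<rho> * (1 + \<rho> * real Y) \<le> c"
        unfolding c using \<rho>Y \<rho> s by (intro mult_left_mono) auto
    qed (use \<rho>(1) \<rho>Y1 s t c0 Y in auto)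
    finally show ?thesis .
  qed
  then have "harm m \<le> max_mean (\<lambda>j. (1 + \<rho>) ^ j) {..<n} +
      s * exp (- real m * exp (- s)) + real m * exp (- u)"
    using \<rho> s by (intro harm_le_max_mean) auto
  moreover have "euler_mascheroni + ln (B - 1) \<le> harm m"
    using harm_ge[OF m(3)] m B(2) ln_mono[of "B - 1" "real m"] by linarith
  moreover have "s * exp (- real m * exp (- s)) \<le> s * exp (- (B - 1) * exp (- s))"
  proof (rule mult_left_mono)
    show "exp (- real m * exp (- s)) \<le> exp (- (B - 1) * exp (- s))"
      using mult_right_mono[OF m(2), of "exp (- s)"]
      by (simp only: exp_le_cancel_iff mult_minus_left neg_le_iff_le exp_ge_zero simp_thms)
  qed (use s in simp)
  moreover have "real m * exp (- u) \<le> B * exp (- u)"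
    using m by (intro mult_right_mono) auto
  ultimately show ?thesis
    by linarith
qed

section \<open>Choice of the parameters and the asymptotic expansion\<close>

lemma max_mean_power_upper:
  fixes lam :: real
  assumes lam: "0 < lam"
  obtains g :: "nat \<Rightarrow> real" where "g \<in> O(\<lambda>n. ln (ln (real n)) / ln (real n))"
    "\<forall>\<^sub>F n in sequentially. max_mean (\<lambda>j. (1 + lam / (real n - lam)) ^ j) {..<n}
      - (ln (real n) - ln (ln (real n)) + euler_mascheroni - ln lam) \<le> g n"
proof -
  \<comment> \<open>Here \<open>exp (- s n) = (ln n)^2 / n\<close>, and \<open>A\<close> is about
    \<open>n / (lam * ln n)\<close>, so \<open>A * exp (- s n)\<close> grows like
    \<open>ln n / lam\<close> and the error from \<open>{0..s}\<close> is negligible. Having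
    \<open>s\<close> in place of \<open>ln n\<close> inside \<open>A\<close> shifts
    \<open>ln A\<close> by about \<open>2 * ln (ln n) / ln n\<close>, the permitted order.\<close>
  define s where "s x = ln x - 2 * ln (ln x)" for x :: real
  \<comment> \<open>This is \<open>lam * A\<close>; then
    \<open>ln (A + 2) = ln (a + 2 * lam) - ln lam\<close>, and \<open>ln lam\<close> cancels before
    the asymptotics.\<close>
  define a where "a x = (lam + (x - lam) / s x) / (1 - exp (- s x))" for x
  define g where "g n = (ln (a (real n) + 2 * lam) - (ln (real n) - ln (ln (real n)))) +
    s (real n) * exp (- (a (real n) / lam) * exp (- s (real n)))" for n
  have "(\<lambda>n. ln (a (real n) + 2 * lam) - (ln (real n) - ln (ln (real n))))
      \<in> O(\<lambda>n. ln (ln (real n)) / ln (real n))"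
    unfolding a_def s_def using lam by real_asymp
  moreover have "(\<lambda>n. s (real n) * exp (- (a (real n) / lam) * exp (- s (real n))))
      \<in> O(\<lambda>n. ln (ln (real n)) / ln (real n))"
    unfolding a_def s_def using lam by real_asymp
  ultimately have "g \<in> O(\<lambda>n. ln (ln (real n)) / ln (real n))"
    unfolding g_def by (rule sum_in_bigo)
  moreover have "\<forall>\<^sub>F n in sequentially. 0 < s (real n)"
    unfolding s_def by real_asymp
  moreover have "\<forall>\<^sub>F n in sequentially. lam < real n"
    by real_asymp
  ultimately show thesis
  proof (elim that)
    assume "\<forall>\<^sub>F n in sequentially. 0 < s (real n)" "\<forall>\<^sub>F n in sequentially. lam < real n"
    then show "\<forall>\<^sub>F n in sequentially. max_mean (\<lambda>j. (1 + lam / (real n - lam)) ^ j) {..<n}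
      - (ln (real n) - ln (ln (real n)) + euler_mascheroni - ln lam) \<le> g n"
    proof eventually_elim
      case (elim n)
      let ?A = "a (real n) / lam"
      have "0 < a (real n)"
        unfolding a_def using elim lam by (intro divide_pos_pos add_pos_pos) auto
      then have "ln ((a (real n) + 2 * lam) / lam) = ln (a (real n) + 2 * lam) - ln lam"
        using lam by (simp add: ln_div)
      moreover have "(a (real n) + 2 * lam) / lam = ?A + 2"
        using lam by (simp add: add_divide_distrib)
      ultimately have ln_A: "ln (?A + 2) = ln (a (real n) + 2 * lam) - ln lam"
        by (simp only:)
      have "?A = (1 + 1 / (s (real n) * (lam / (real n - lam)))) / (1 - exp (- s (real n)))"
        unfolding a_def using elim lam by (simp add: field_simps)
      then have "max_mean (\<lambda>j. (1 + lam / (real n - lam)) ^ j) {..<n} \<le>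
          euler_mascheroni + ln (?A + 2) + s (real n) * exp (- ?A * exp (- s (real n)))"
        using elim lam by (intro max_mean_power_le) auto
      then show ?case
        unfolding g_def using ln_A by linarith
    qed
  qed
qed

lemma max_mean_power_lower:
  fixes lam :: real
  assumes lam: "0 < lam"
  obtains g :: "nat \<Rightarrow> real" where "g \<in> O(\<lambda>n. ln (ln (real n)) / ln (real n))"
    "\<forall>\<^sub>F n in sequentially. g n \<le> max_mean (\<lambda>j. (1 + lam / (real n - lam)) ^ j) {..<n}
      - (ln (real n) - ln (ln (real n)) + euler_mascheroni - ln lam)"
proof -
  define s where "s x = ln x - 2 * ln (ln x)" for x :: real
  \<comment> \<open>Truncating the sum after about \<open>y\<close> terms loses only a factor \<open>1 - O(1 / ln n)\<close>, while
    \<open>(1 + lam / (n - lam)) ^ j\<close> is still almost linear for \<open>j \<le> y\<close>.\<close>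
  define y where "y x = x * ln (ln x) / (lam * ln x)" for x
  \<comment> \<open>With the cut-off \<open>u = ln n\<close>, \<open>lam * \<kappa>\<close> is the
    \<open>c\<close> of \<open>le_max_mean_power\<close> and \<open>b\<close> is
    \<open>lam * B\<close>. The correction \<open>\<rho> * (y + 1)\<close> is of order
    \<open>ln (ln n) / ln n\<close>, again the permitted error.\<close>
  define \<kappa> where "\<kappa> x = ln x * (1 / (x - lam)) * (1 + lam * (1 / (x - lam)) * (y x + 1))" for x
  define b where "b x = (1 - exp (- s x)) * (1 - exp (- lam * \<kappa> x * y x)) / \<kappa> x" for x
  note defs = b_def \<kappa>_def y_def s_def
  \<comment> \<open>The last term is \<open>B * exp (- u)\<close> at \<open>u = ln n\<close>, of
    order \<open>1 / ln n\<close>.\<close>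
  define g where "g n = (ln (b (real n) - lam) - (ln (real n) - ln (ln (real n)))) -
    s (real n) * exp (- (b (real n) / lam - 1) * exp (- s (real n))) - b (real n) / lam / real n" for n
  have o1: "(\<lambda>n. ln (b (real n) - lam) - (ln (real n) - ln (ln (real n))))
      \<in> O(\<lambda>n. ln (ln (real n)) / ln (real n))"
    unfolding defs using lam by real_asymp
  have o2: "(\<lambda>n. s (real n) * exp (- (b (real n) / lam - 1) * exp (- s (real n))))
      \<in> O(\<lambda>n. ln (ln (real n)) / ln (real n))"
    unfolding defs using lam by real_asymp
  have o3: "(\<lambda>n. b (real n) / lam / real n) \<in> O(\<lambda>n. ln (ln (real n)) / ln (real n))"
    unfolding defs using lam by real_asymp
  have g: "g \<in> O(\<lambda>n. ln (ln (real n)) / ln (real n))"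
    unfolding g_def by (rule sum_in_bigo(2)[OF sum_in_bigo(2)[OF o1 o2] o3])
  have "\<forall>\<^sub>F n in sequentially. 0 < s (real n) \<and> s (real n) \<le> ln (real n)"
    unfolding defs by (intro eventually_conj) real_asymp+
  moreover have "\<forall>\<^sub>F n in sequentially. lam < real n"
    by real_asymp
  moreover have "\<forall>\<^sub>F n in sequentially. 0 \<le> y (real n)"
    unfolding defs using lam by real_asymp
  moreover have "\<forall>\<^sub>F n in sequentially. y (real n) + 1 \<le> real n"
    unfolding defs using lam by real_asymp
  moreover have "\<forall>\<^sub>F n in sequentially. lam / (real n - lam) * (y (real n) + 1) \<le> 1"
    unfolding defs using lam by real_asymp
  moreover have "\<forall>\<^sub>F n in sequentially. lam < b (real n)"
    unfolding defs using lam by real_asymp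
  ultimately have "\<forall>\<^sub>F n in sequentially. g n \<le> max_mean (\<lambda>j. (1 + lam / (real n - lam)) ^ j) {..<n}
      - (ln (real n) - ln (ln (real n)) + euler_mascheroni - ln lam)"
  proof (elim eventually_rev_mp, intro always_eventually allI impI, goal_cases)
    case (1 n)
    let ?B = "b (real n) / lam"
    let ?\<rho> = "lam / (real n - lam)"
    have "ln ((b (real n) - lam) / lam) = ln (b (real n) - lam) - ln lam"
      using 1 lam by (simp add: ln_div)
    moreover have "(b (real n) - lam) / lam = ?B - 1"
      using lam by (simp add: diff_divide_distrib)
    ultimately have ln_B: "ln (?B - 1) = ln (b (real n) - lam) - ln lam"
      by (simp only:)
    have \<kappa>: "lam * \<kappa> (real n) = ln (real n) * ?\<rho> * (1 + ?\<rho> * (y (real n) + 1))"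
      unfolding \<kappa>_def by simp
    have "euler_mascheroni + ln (?B - 1) - s (real n) * exp (- (?B - 1) * exp (- s (real n)))
        - ?B * exp (- ln (real n)) \<le> max_mean (\<lambda>j. (1 + ?\<rho>) ^ j) {..<n}"
    proof (rule le_max_mean_power[where y = "y (real n)" and c = "lam * \<kappa> (real n)", OF _ _ _ _ _ _ \<kappa>])
      show "?B = (1 - exp (- s (real n))) * (1 - exp (- (lam * \<kappa> (real n)) * y (real n))) /
          (lam * \<kappa> (real n))"
        unfolding b_def by (simp add: mult.commute)
    qed (use 1 lam in auto)
    moreover have "?B * exp (- ln (real n)) = ?B / real n"
      using 1 lam by (simp add: exp_minus divide_inverse)
    ultimately show ?case
      unfolding g_def using ln_B by linarith
  qed
  with g show thesis
    by (rule that)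
qed

lemma max_mean_power_asymp:
  fixes lam :: real
  assumes "0 < lam"
  shows "(\<lambda>n. max_mean (\<lambda>j. (1 + lam / (real n - lam)) ^ j) {..<n}
      - (ln (real n) - ln (ln (real n)) + euler_mascheroni - ln lam))
    \<in> O(\<lambda>n. ln (ln (real n)) / ln (real n))"
proof -
  obtain f where f: "f \<in> O(\<lambda>n. ln (ln (real n)) / ln (real n))"
    "\<forall>\<^sub>F n in sequentially. max_mean (\<lambda>j. (1 + lam / (real n - lam)) ^ j) {..<n}
      - (ln (real n) - ln (ln (real n)) + euler_mascheroni - ln lam) \<le> f n"
    using max_mean_power_upper[OF assms] .
  obtain g where g: "g \<in> O(\<lambda>n. ln (ln (real n)) / ln (real n))"
    "\<forall>\<^sub>F n in sequentially. g n \<le> max_mean (\<lambda>j. (1 + lam / (real n - lam)) ^ j) {..<n}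
      - (ln (real n) - ln (ln (real n)) + euler_mascheroni - ln lam)"
    using max_mean_power_lower[OF assms] .
  \<comment> \<open>A quantity between \<open>g\<close> and \<open>f\<close> is bounded in absolute
    value by this sum.\<close>
  have "(\<lambda>n. \<bar>f n\<bar> + \<bar>g n\<bar>) \<in> O(\<lambda>n. ln (ln (real n)) / ln (real n))"
    using f(1) g(1) by (intro sum_in_bigo) simp_all
  moreover have "(\<lambda>n. max_mean (\<lambda>j. (1 + lam / (real n - lam)) ^ j) {..<n}
      - (ln (real n) - ln (ln (real n)) + euler_mascheroni - ln lam)) \<in> O(\<lambda>n. \<bar>f n\<bar> + \<bar>g n\<bar>)"
    using f(2) g(2)
    by (intro bigoI[of _ 1], eventually_elim) auto
  ultimately show ?thesis
    by (rule landau_o.big_trans[rotated])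
qed

section \<open>Back to the coupon probabilities\<close>

text \<open>Dividing by the smallest rate, that of type \<open>n\<close>, turns rate
  \<open>i\<close> into \<open>(1 / (1 - p)) ^ (n - i)\<close>, and
  \<open>1 / (1 - p) = 1 + lam / (real n - lam)\<close>. Reversing the order of the types gives
  exponents \<open>j < n\<close>.\<close>

lemma max_mean_coupon_prob:
  assumes lam: "0 < lam" "lam < real n"
  shows "max_mean (coupon_prob lam n) {1..n} =
    real n / lam * (1 - lam / real n) powr (1 - real n) *
      max_mean (\<lambda>j. (1 + lam / (real n - lam)) ^ j) {..<n}"
proof -
  define p where "p = lam / real n"
  define q where "q = p * (1 - p) ^ (n - 1)"
  have p: "0 < p" "p < 1"
    using lam by (auto simp: p_def)
  have n: "1 \<le> n"
    using lam by (cases n) auto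
  have r: "1 + lam / (real n - lam) = inverse (1 - p)"
    using lam by (simp add: p_def field_simps)
  have coupon_prob: "coupon_prob lam n i = q * (1 + lam / (real n - lam)) ^ (n - i)" if i: "i \<in> {1..n}" for i
  proof -
    have "n - 1 = (i - 1) + (n - i)"
      using i by auto
    then have "(1 - p) ^ (n - 1) = (1 - p) ^ (i - 1) * (1 - p) ^ (n - i)"
      by (simp only: power_add)
    with i p show ?thesis
      unfolding r by (simp add: coupon_prob_def q_def power_inverse flip: p_def)
  qed
  have "max_mean (coupon_prob lam n) {1..n} =
      max_mean (\<lambda>i. (1 + lam / (real n - lam)) ^ (n - i)) {1..n} / q"
    unfolding max_mean_scale[symmetric] by (rule max_mean_cong) (rule coupon_prob)
  also have "max_mean (\<lambda>i. (1 + lam / (real n - lam)) ^ (n - i)) {1..n} =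
      max_mean (\<lambda>j. (1 + lam / (real n - lam)) ^ (n - (n - j))) {..<n}"
    by (rule max_mean_reindex, rule bij_betwI[where g = "\<lambda>i. n - i"]) auto
  also have "\<dots> = max_mean (\<lambda>j. (1 + lam / (real n - lam)) ^ j) {..<n}"
    by (rule max_mean_cong) auto
  also have "q = lam / real n * (1 - lam / real n) powr (real n - 1)"
    using p n by (simp add: q_def p_def powr_realpow[symmetric] of_nat_diff)
  finally show ?thesis
    using powr_minus[of "1 - lam / real n" "real n - 1"] by (simp add: field_simps)
qed

theorem theorem3:
  fixes lam :: real
    and M :: "nat \<Rightarrow> 'a measure" and X :: "nat \<Rightarrow> nat \<Rightarrow> 'a \<Rightarrow> nat"
    and N :: "nat \<Rightarrow> 'b measure" and T :: "nat \<Rightarrow> nat \<Rightarrow> 'b \<Rightarrow> real"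
  assumes "lam > 0"
    and "\<And>n. real n > lam \<Longrightarrow> coupon_draws lam n (M n) (X n)"
    and "\<And>n. real n > lam \<Longrightarrow> coupon_clocks lam n (N n) (T n)"
  shows "(\<forall>n. real n > lam \<longrightarrow>
            integrable (N n) (max_time n (T n)) \<and>
            (\<integral>\<^sup>+\<omega>. ennreal_of_enat (draws_needed n (X n) \<omega>) \<partial>M n)
              = ennreal (\<integral>\<omega>. max_time n (T n) \<omega> \<partial>N n)) \<and>
         (\<lambda>n. (\<integral>\<omega>. max_time n (T n) \<omega> \<partial>N n)
              - exp lam / lam * real n * (ln (real n) - ln (ln (real n)) + euler_mascheroni - ln lam))
           \<in> O(\<lambda>n. real n * ln (ln (real n)) / ln (real n))"
proof
  have pos: "0 < coupon_prob lam n i" if "lam < real n" "i \<in> {1..n}" for n i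
    using that assms(1) by (auto simp: coupon_prob_def Let_def)
  have T: "has_bochner_integral (N n) (max_time n (T n)) (max_mean (coupon_prob lam n) {1..n})"
    if n: "lam < real n" for n
  proof -
    have clocks: "coupon_clocks lam n (N n) (T n)"
      using n by (rule assms(3))
    then interpret prob_space "N n"
      by (simp add: coupon_clocks_def)
    have "{1..n} \<noteq> {}"
      using n assms(1) by (cases n) auto
    then show ?thesis
      unfolding max_time_def using clocks pos[OF n] by (intro exponential_Max) (auto simp: coupon_clocks_def)
  qed
  have D: "(\<integral>\<^sup>+\<omega>. ennreal_of_enat (draws_needed n (X n) \<omega>) \<partial>M n) =
      ennreal (max_mean (coupon_prob lam n) {1..n})" if n: "lam < real n" for n
  proof -
    have draws: "coupon_draws lam n (M n) (X n)"
      using n by (rule assms(2))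
    then interpret prob_space "M n"
      by (simp add: coupon_draws_def)
    show ?thesis
      using draws pos[OF n] by (intro nn_integral_draws_needed) (auto simp: coupon_draws_def)
  qed
  \<comment> \<open>Both models have the same inclusion-exclusion value.\<close>
  show "\<forall>n. real n > lam \<longrightarrow>
      integrable (N n) (max_time n (T n)) \<and>
      (\<integral>\<^sup>+\<omega>. ennreal_of_enat (draws_needed n (X n) \<omega>) \<partial>M n)
        = ennreal (\<integral>\<omega>. max_time n (T n) \<omega> \<partial>N n)"
    using T D by (simp add: has_bochner_integral_iff)
  define L where "L n = ln (real n) - ln (ln (real n)) + euler_mascheroni - ln lam" for n :: nat
  define h where "h n = max_mean (\<lambda>j. (1 + lam / (real n - lam)) ^ j) {..<n}" for n
  define Q where "Q n = real n / lam * (1 - lam / real n) powr (1 - real n)" for n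
  let ?E = "\<lambda>n. real n * ln (ln (real n)) / ln (real n)"
  \<comment> \<open>Eventually the mean is \<open>Q n * h n\<close>, so the total error is this term
    plus \<open>(Q n - exp lam / lam * real n) * L n\<close>. The first carries the stated order;
    the second is only \<open>O(ln n)\<close>.\<close>
  have "(\<lambda>n. Q n * (h n - L n)) \<in> O(\<lambda>n. real n * (ln (ln (real n)) / ln (real n)))"
  proof (rule landau_o.big.mult)
    show "Q \<in> O(\<lambda>n. real n)"
      unfolding Q_def using assms(1) by real_asymp
    show "(\<lambda>n. h n - L n) \<in> O(\<lambda>n. ln (ln (real n)) / ln (real n))"
      unfolding h_def L_def by (rule max_mean_power_asymp[OF assms(1)])
  qed
  moreover have "(\<lambda>n. (Q n - exp lam / lam * real n) * L n) \<in> O(\<lambda>n. 1 * ln (real n))"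
  proof (rule landau_o.big.mult)
    \<comment> \<open>With \<open>exp lam\<close> factored out of \<open>Q n\<close>, the remaining
      exponent is \<open>O(1 / n)\<close>, so \<open>Q n\<close> is within a bounded distance of its
      linear main term.\<close>
    have "(\<lambda>n. exp lam / lam * (real n * (exp ((1 - real n) * ln (1 - lam / real n) - lam) - 1)))
        \<in> O(\<lambda>_. 1)"
      using assms(1) by real_asymp
    moreover have "\<forall>\<^sub>F n in sequentially. lam < real n"
      by real_asymp
    then have "\<forall>\<^sub>F n in sequentially.
        exp lam / lam * (real n * (exp ((1 - real n) * ln (1 - lam / real n) - lam) - 1)) =
        Q n - exp lam / lam * real n"
      by eventually_elim (use assms(1) in \<open>auto simp: Q_def powr_def exp_diff right_diff_distrib\<close>)
    ultimately show "(\<lambda>n. Q n - exp lam / lam * real n) \<in> O(\<lambda>_. 1)"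
      by (simp add: landau_o.big.in_cong)
    show "L \<in> O(\<lambda>n. ln (real n))"
      unfolding L_def by real_asymp
  qed
  moreover have "(\<lambda>n. 1 * ln (real n)) \<in> O(?E)"
    by real_asymp
  ultimately have "(\<lambda>n. Q n * (h n - L n) + (Q n - exp lam / lam * real n) * L n) \<in> O(?E)"
    by (intro sum_in_bigo) (auto intro: landau_o.big_trans)
  moreover have "\<forall>\<^sub>F n in sequentially. Q n * (h n - L n) + (Q n - exp lam / lam * real n) * L n =
      (\<integral>\<omega>. max_time n (T n) \<omega> \<partial>N n) - exp lam / lam * real n * L n"
  proof -
    have "\<forall>\<^sub>F n in sequentially. lam < real n"
      by real_asymp
    then show ?thesis
    proof eventually_elim
      case (elim n)
      have "(\<integral>\<omega>. max_time n (T n) \<omega> \<partial>N n) = Q n * h n"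
        using T[OF elim] max_mean_coupon_prob[OF assms(1) elim]
        by (simp add: has_bochner_integral_iff Q_def h_def)
      then show ?case
        by (simp add: algebra_simps)
    qed
  qed
  ultimately show "(\<lambda>n. (\<integral>\<omega>. max_time n (T n) \<omega> \<partial>N n)
      - exp lam / lam * real n * (ln (real n) - ln (ln (real n)) + euler_mascheroni - ln lam)) \<in> O(?E)"
    unfolding L_def[symmetric] by (simp add: landau_o.big.in_cong)
qed

end
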